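(* Let $k\ge2$ and $m>n\ge2$ be integers. The following are equivalent: (1) there exist functions $g,f_0,\dots,f_{k-1}:m\to n$ such that for all distinct $\ell,\ell'<k$, there is no pair $\{i,j\}$ with $i\ne j$ that is a $\mathsf{PHP}^m_n$-solution to all three of $f_\ell$, $f_{\ell'}$ and $g$; (2) $\mathsf{AUC}_k\le_{\mathrm W}(\mathsf{PHP}^m_n)'$; (3) $\mathsf{AUC}_k\le^*_{\mathrm W}(\mathsf{PHP}^m_n)'$.
   Context: A number $N\ge1$ is identified with $\{0,\dots,N-1\}$. A problem $\mathsf{P}$ consists of a nonempty set of instances and, for each instance $x$, a nonempty set of solutions; instances and solutions are coded as elements of Baire space $\mathbb N^{\mathbb N}$ in a standard way. $\mathsf{P}\le_{\mathrm W}\mathsf{Q}$ (Weihrauch reducibility) if there are Turing functionals (effectively continuous partial maps on $\mathbb N^{\mathbb N}$) $\Phi,\Psi$ such that for every $\mathsf{P}$-instance $p$, $\Phi(p)$ is a $\mathsf{Q}$-instance and for every $\mathsf{Q}$-solution $q$ of $\Phi(p)$, $\Psi(p,q)$ is a $\mathsf{P}$-solution of $p$; $\le^*_{\mathrm W}$ is the same with $\Phi,\Psi$ merely continuous. For $m>n\ge2$, $\mathsf{PHP}^m_n$ has as instances all functions $f:m\to n$, with solutions all unordered pairs $\{i,j\}$, $i\ne j$, $f(i)=f(j)$; its jump $(\mathsf{PHP}^m_n)'$ has as instances all pointwise convergent sequences $(f_s:m\to n)_{s\in\mathbb N}$, with solutions all $\{i,j\}$, $i\ne j$, $\lim_s f_s(i)=\lim_s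 f_s(j)$. For $k\ge2$, $\mathsf{AUC}_k$ has as instances those $p\in\mathbb N^{\mathbb N}$ such that either there is a unique $\ell<k$ not appearing in $p$ (then $\ell$ is the unique solution), or $p$ is the constant sequence with value $k$ (then every $j<k$ is a solution). *)

theory Defs
  imports "HOL-Analysis.Function_Topology" "HOL-Library.Nat_Bijection" "HOL-Library.FuncSet"
begin

type_synonym baire = "nat \<Rightarrow> nat"

text \<open>Partial recursive functions relative to an oracle (Kleene's schemes plus an oracle query).\<close>

datatype oprog =
    Zero
  | Succ
  | Proj nat
  | Query
  | Comp oprog "oprog list"
  | PrimRec oprog oprog
  | Minim oprog

text \<open>The value of a program for an oracle on a list of arguments; \<open>None\<close> means divergence
  (or arguments of the wrong arity). The operation \<open>those\<close> makes composition strict, and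
  \<open>Minim\<close> is unbounded search, which diverges as soon as some earlier value diverges.\<close>

fun oeval :: "oprog \<Rightarrow> baire \<Rightarrow> nat list \<Rightarrow> nat option" where
  "oeval Zero p xs = Some 0"
| "oeval Succ p xs = (case xs of [x] \<Rightarrow> Some (Suc x) | _ \<Rightarrow> None)"
| "oeval (Proj i) p xs = (if i < length xs then Some (xs ! i) else None)"
| "oeval Query p xs = (case xs of [x] \<Rightarrow> Some (p x) | _ \<Rightarrow> None)"
| "oeval (Comp h gs) p xs = Option.bind (those (map (\<lambda>g. oeval g p xs) gs)) (oeval h p)"
| "oeval (PrimRec g h) p xs =
    (case xs of
       [] \<Rightarrow> None
     | n # ys \<Rightarrow>
         rec_nat (oeval g p ys) (\<lambda>i r. Option.bind r (\<lambda>v. oeval h p (i # v # ys))) n)"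
| "oeval (Minim g) p xs =
    (if \<exists>n. oeval g p (n # xs) = Some 0 \<and> (\<forall>i<n. oeval g p (i # xs) \<noteq> None)
     then Some (LEAST n. oeval g p (n # xs) = Some 0)
     else None)"

text \<open>Partial maps on Baire space. A program \<open>e\<close> sends \<open>p\<close> to the sequence
  it computes from oracle \<open>p\<close>, provided that this sequence is total.\<close>

definition functional_of :: "oprog \<Rightarrow> baire \<rightharpoonup> baire" where
  "functional_of e p =
    (if \<forall>n. oeval e p [n] \<noteq> None then Some (\<lambda>n. the (oeval e p [n])) else None)"

definition turing_functional :: "(baire \<rightharpoonup> baire) \<Rightarrow> bool" where
  "turing_functional \<Phi> \<longleftrightarrow> (\<exists>e. \<Phi> = functional_of e)"

text \<open>The type \<^typ>\<open>nat \<Rightarrow> nat\<close> carries the product of the discrete topologies.\<close>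

definition continuous_functional :: "(baire \<rightharpoonup> baire) \<Rightarrow> bool" where
  "continuous_functional \<Phi> \<longleftrightarrow> continuous_on (dom \<Phi>) (\<lambda>p. the (\<Phi> p))"

definition join :: "baire \<Rightarrow> baire \<Rightarrow> baire" where
  "join p q = (\<lambda>n. if even n then p (n div 2) else q (n div 2))"

text \<open>\<open>inst_name P p x\<close> says that \<open>p\<close> is a code of the instance \<open>x\<close>;
  \<open>sol_name P q y\<close> says that \<open>q\<close> is a code of the solution \<open>y\<close>.\<close>

record ('x, 'y) problem =
  instances :: "'x set"
  solutions :: "'x \<Rightarrow> 'y set"
  inst_name :: "baire \<Rightarrow> 'x \<Rightarrow> bool"
  sol_name :: "baire \<Rightarrow> 'y \<Rightarrow> bool"

definition wf_problem :: "('x, 'y) problem \<Rightarrow> bool" where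
  "wf_problem P \<longleftrightarrow>
    instances P \<noteq> {} \<and>
    (\<forall>x\<in>instances P. solutions P x \<noteq> {}) \<and>
    (\<forall>x\<in>instances P. \<exists>p. inst_name P p x) \<and>
    (\<forall>x\<in>instances P. \<forall>x'\<in>instances P. \<forall>p. inst_name P p x \<longrightarrow> inst_name P p x' \<longrightarrow> x = x') \<and>
    (\<forall>x\<in>instances P. \<forall>y\<in>solutions P x. \<exists>q. sol_name P q y) \<and>
    (\<forall>x\<in>instances P. \<forall>x'\<in>instances P. \<forall>y\<in>solutions P x. \<forall>y'\<in>solutions P x'. \<forall>q.
       sol_name P q y \<longrightarrow> sol_name P q y' \<longrightarrow> y = y')"

definition reduces_via ::
  "(baire \<rightharpoonup> baire) \<Rightarrow> (baire \<rightharpoonup> baire) \<Rightarrow> ('x, 'y) problem \<Rightarrow> ('u, 'v) problem \<Rightarrow> bool" where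
  "reduces_via \<Phi> \<Psi> P Q \<longleftrightarrow>
    (\<forall>x\<in>instances P. \<forall>p. inst_name P p x \<longrightarrow>
      (\<exists>p'. \<Phi> p = Some p' \<and>
        (\<exists>u\<in>instances Q. inst_name Q p' u \<and>
          (\<forall>v\<in>solutions Q u. \<forall>q. sol_name Q q v \<longrightarrow>
            (\<exists>r. \<Psi> (join p q) = Some r \<and> (\<exists>y\<in>solutions P x. sol_name P r y))))))"

definition weihrauch_le :: "('x, 'y) problem \<Rightarrow> ('u, 'v) problem \<Rightarrow> bool"
    (infix \<open>\<le>\<^sub>W\<close> 50) where
  "P \<le>\<^sub>W Q \<longleftrightarrow>
    (\<exists>\<Phi> \<Psi>. turing_functional \<Phi> \<and> turing_functional \<Psi> \<and> reduces_via \<Phi> \<Psi> P Q)"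

definition cont_weihrauch_le :: "('x, 'y) problem \<Rightarrow> ('u, 'v) problem \<Rightarrow> bool"
    (infix \<open>\<le>\<^sup>*\<^sub>W\<close> 50) where
  "P \<le>\<^sup>*\<^sub>W Q \<longleftrightarrow>
    (\<exists>\<Phi> \<Psi>. continuous_functional \<Phi> \<and> continuous_functional \<Psi> \<and> reduces_via \<Phi> \<Psi> P Q)"

text \<open>A number, and likewise a finite object via its number, is coded by any sequence that
  has this number as its first entry. A function on \<open>{..<m}\<close> is numbered by its list of values,
  a finite set by its canonical index.\<close>

definition fun_code :: "nat \<Rightarrow> (nat \<Rightarrow> nat) \<Rightarrow> nat" where
  "fun_code m f = list_encode (map f [0..<m])"

definition PHP :: "nat \<Rightarrow> nat \<Rightarrow> (nat \<Rightarrow> nat, nat set) problem" where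
  "PHP m n =
    \<lparr> instances = {..<m} \<rightarrow>\<^sub>E {..<n},
      solutions = (\<lambda>f. {{i, j} | i j. i < m \<and> j < m \<and> i \<noteq> j \<and> f i = f j}),
      inst_name = (\<lambda>p f. p 0 = fun_code m f),
      sol_name = (\<lambda>q A. q 0 = set_encode A) \<rparr>"

definition PHP_jump :: "nat \<Rightarrow> nat \<Rightarrow> (nat \<Rightarrow> nat \<Rightarrow> nat, nat set) problem" where
  "PHP_jump m n =
    \<lparr> instances = {F. (\<forall>s. F s \<in> {..<m} \<rightarrow>\<^sub>E {..<n}) \<and> (\<forall>i<m. convergent (\<lambda>s. F s i))},
      solutions = (\<lambda>F. {{i, j} | i j. i < m \<and> j < m \<and> i \<noteq> j \<and>
                                      lim (\<lambda>s. F s i) = lim (\<lambda>s. F s j)}),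
      inst_name = (\<lambda>p F. \<forall>s. p s = fun_code m (F s)),
      sol_name = (\<lambda>q A. q 0 = set_encode A) \<rparr>"

definition AUC :: "nat \<Rightarrow> (baire, nat) problem" where
  "AUC k =
    \<lparr> instances = {p. (\<exists>!l. l < k \<and> l \<notin> range p) \<or> p = (\<lambda>_. k)},
      solutions = (\<lambda>p. if p = (\<lambda>_. k) then {..<k} else {l. l < k \<and> l \<notin> range p}),
      inst_name = (\<lambda>p x. p = x),
      sol_name = (\<lambda>q l. q 0 = l) \<rparr>"

lemma pigeonhole_pair:
  assumes "\<And>i. i < m \<Longrightarrow> f i < n" and "n < m"
  obtains i j where "i < m" "j < m" "i \<noteq> j" "f i = (f j :: nat)"
proof -
  have "card (f ` {..<m}) \<le> card {..<n}"
    using assms(1) by (intro card_mono) auto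
  then have "\<not> inj_on f {..<m}"
    using assms(2) by (intro pigeonhole) auto
  then show thesis
    using that by (auto simp: inj_on_def)
qed

lemma fun_code_inj:
  assumes "f \<in> {..<m} \<rightarrow>\<^sub>E B" "g \<in> {..<m} \<rightarrow>\<^sub>E B" "fun_code m f = fun_code m g"
  shows "f = g"
proof (rule PiE_ext[OF assms(1,2)])
  fix i assume "i \<in> {..<m}"
  moreover have "map f [0..<m] = map g [0..<m]"
    using assms(3) by (simp add: fun_code_def list_encode_eq)
  ultimately show "f i = g i"
    by (simp add: map_eq_conv)
qed

lemma wf_AUC:
  assumes "k \<ge> 2"
  shows "wf_problem (AUC k)"
proof -
  have "{..<k} \<noteq> {}"
    using assms by (auto simp: lessThan_empty_iff)
  then show ?thesis
    unfolding wf_problem_def AUC_def by (auto intro: exI[of _ "\<lambda>_. _"])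
qed

lemma wf_PHP:
  assumes "m > n" "n \<ge> 2"
  shows "wf_problem (PHP m n)"
proof -
  have "instances (PHP m n) \<noteq> {}"
    using assms by (auto simp: PHP_def PiE_eq_empty_iff lessThan_empty_iff)
  moreover have "solutions (PHP m n) f \<noteq> {}" if f: "f \<in> instances (PHP m n)" for f
  proof -
    have "f i < n" if "i < m" for i
      using f that by (auto simp: PHP_def PiE_iff)
    then obtain i j where "i < m" "j < m" "i \<noteq> j" "f i = f j"
      using pigeonhole_pair assms(1) by metis
    then have "{i, j} \<in> solutions (PHP m n) f"
      by (auto simp: PHP_def)
    then show ?thesis by blast
  qed
  moreover have "f = g"
    if "f \<in> instances (PHP m n)" "g \<in> instances (PHP m n)"
      "inst_name (PHP m n) p f" "inst_name (PHP m n) p g" for f g p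
    using that by (intro fun_code_inj[of _ m "{..<n}"]) (auto simp: PHP_def)
  moreover have "\<exists>p. inst_name (PHP m n) p f" for f
    by (rule exI[of _ "\<lambda>_. fun_code m f"]) (simp add: PHP_def)
  moreover have "\<exists>q. sol_name (PHP m n) q A" for A
    by (rule exI[of _ "\<lambda>_. set_encode A"]) (simp add: PHP_def)
  moreover have "A = B"
    if "A \<in> solutions (PHP m n) f" "B \<in> solutions (PHP m n) g"
      "sol_name (PHP m n) q A" "sol_name (PHP m n) q B" for A B f g q
  proof -
    have "finite A" "finite B" "set_encode A = set_encode B"
      using that unfolding PHP_def by fastforce+
    then show ?thesis by (simp add: set_encode_eq)
  qed
  ultimately show ?thesis
    unfolding wf_problem_def by blast
qed

lemma wf_PHP_jump:
  assumes "m > n" "n \<ge> 2"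
  shows "wf_problem (PHP_jump m n)"
proof -
  have "(\<lambda>i\<in>{..<m}. 0) \<in> {..<m} \<rightarrow>\<^sub>E {..<n}"
    using assms by auto
  then have "(\<lambda>s. \<lambda>i\<in>{..<m}. 0) \<in> instances (PHP_jump m n)"
    by (simp add: PHP_jump_def convergent_const del: restrict_PiE_iff)
  then have "instances (PHP_jump m n) \<noteq> {}"
    by blast
  moreover have "solutions (PHP_jump m n) F \<noteq> {}" if F: "F \<in> instances (PHP_jump m n)" for F
  proof -
    have "lim (\<lambda>s. F s i) < n" if i: "i < m" for i
    proof -
      have "(\<lambda>s. F s i) \<longlonglongrightarrow> lim (\<lambda>s. F s i)"
        using F i by (simp add: PHP_jump_def convergent_LIMSEQ_iff)
      then obtain s where "F s i = lim (\<lambda>s. F s i)"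
        unfolding tendsto_discrete eventually_sequentially by blast
      moreover have "F s i < n"
        using F i by (auto simp: PHP_jump_def PiE_iff)
      ultimately show ?thesis by simp
    qed
    then obtain i j where "i < m" "j < m" "i \<noteq> j" "lim (\<lambda>s. F s i) = lim (\<lambda>s. F s j)"
      using pigeonhole_pair[of m "\<lambda>i. lim (\<lambda>s. F s i)" n] assms(1) by metis
    then have "{i, j} \<in> solutions (PHP_jump m n) F"
      by (auto simp: PHP_jump_def)
    then show ?thesis by blast
  qed
  moreover have "F = G"
    if "F \<in> instances (PHP_jump m n)" "G \<in> instances (PHP_jump m n)"
      "inst_name (PHP_jump m n) p F" "inst_name (PHP_jump m n) p G" for F G p
  proof
    fix s show "F s = G s"
      using that by (intro fun_code_inj[of _ m "{..<n}"]) (auto simp: PHP_jump_def)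
  qed
  moreover have "\<exists>p. inst_name (PHP_jump m n) p F" for F
    by (rule exI[of _ "\<lambda>s. fun_code m (F s)"]) (simp add: PHP_jump_def)
  moreover have "\<exists>q. sol_name (PHP_jump m n) q A" for A
    by (rule exI[of _ "\<lambda>_. set_encode A"]) (simp add: PHP_jump_def)
  moreover have "A = B"
    if "A \<in> solutions (PHP_jump m n) F" "B \<in> solutions (PHP_jump m n) G"
      "sol_name (PHP_jump m n) q A" "sol_name (PHP_jump m n) q B" for A B F G q
  proof -
    have "finite A" "finite B" "set_encode A = set_encode B"
      using that unfolding PHP_jump_def by fastforce+
    then show ?thesis by (simp add: set_encode_eq)
  qed
  ultimately show ?thesis
    unfolding wf_problem_def by blast
qed

end

theory Submission
  imports Defs
begin

text \<open>
  Given separating functions, output \<open>g\<close> until all but one of the numbers below \<open>k\<close>, say all but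
  \<open>l\<close>, have appeared in the instance, and \<open>f l\<close> from then on. If a pair solves the limit but
  not \<open>g\<close>, then the limit is not \<open>g\<close>, so one can wait for \<open>l\<close>; if it solves \<open>g\<close>, then it solves
  at most one \<open>f l\<close>, and this \<open>l\<close> is read off a finite table.

  Conversely, for the instance with constant value \<open>k\<close> a continuous reduction produces some limit
  \<open>g\<close>, and on each of the finitely many solutions of \<open>g\<close> its answer depends only on the first \<open>N\<close>
  entries of the instance. Let \<open>f l\<close> be the limit produced for an instance that misses exactly
  \<open>l\<close> and starts with \<open>N\<close> copies of \<open>k\<close>. A common solution of \<open>g\<close>, \<open>f l\<close> and \<open>f l'\<close> would
  have to be answered both by \<open>l\<close> and by \<open>l'\<close>.
\<close>

section \<open>Continuity of Turing functionals\<close>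

lemma eventually_nhds_coordinate:
  fixes p :: baire
  shows "\<forall>\<^sub>F p' in nhds p. p' x = p x"
proof -
  have "open ((\<lambda>q::baire. q x) -` {p x})"
    by (intro open_vimage open_discrete) auto
  then show ?thesis
    unfolding eventually_nhds by (intro exI[of _ "(\<lambda>q::baire. q x) -` {p x}"]) auto
qed

lemma those_eq_Some_iff: "those xs = Some ys \<longleftrightarrow> xs = map Some ys"
proof (induction xs arbitrary: ys)
  case (Cons x xs)
  show ?case
    by (cases x; cases ys) (auto simp: Cons.IH)
qed auto

lemma those_map_Some [simp]: "those (map Some ys) = Some ys"
  by (simp add: those_eq_Some_iff)

text \<open>A converging computation consults the oracle at finitely many places only. In
  topological form this is a finite intersection of neighbourhoods, built along the structure of the
  program.\<close>

lemma oeval_eventually_nhds: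
  "oeval e p xs = Some v \<Longrightarrow> \<forall>\<^sub>F p' in nhds p. oeval e p' xs = Some v"
proof (induction e arbitrary: xs v)
  case Query
  then show ?case
    using eventually_nhds_coordinate[where p = p]
    by (auto split: list.splits elim: eventually_mono)
next
  case (Comp h gs)
  from Comp.prems obtain vs where vs: "map (\<lambda>g. oeval g p xs) gs = map Some vs"
      and h: "oeval h p vs = Some v"
    by (auto simp: bind_eq_Some_conv those_eq_Some_iff)
  have "\<forall>\<^sub>F p' in nhds p. oeval g p' xs = oeval g p xs" if g: "g \<in> set gs" for g
  proof -
    from g have "oeval g p xs \<in> set (map Some vs)"
      using vs[symmetric] by auto
    then obtain w where "oeval g p xs = Some w" by auto
    then show ?thesis using Comp.IH(2)[OF g] by simp
  qed
  then have "\<forall>\<^sub>F p' in nhds p. \<forall>g\<in>set gs. oeval g p' xs = oeval g p xs"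
    by (intro eventually_ball_finite) auto
  then show ?case
    using Comp.IH(1)[OF h]
  proof eventually_elim
    case (elim p')
    then have "map (\<lambda>g. oeval g p' xs) gs = map Some vs"
      using vs by (metis (no_types, lifting) map_eq_conv)
    with elim show ?case by (simp only: oeval.simps those_map_Some bind.simps)
  qed
next
  case (PrimRec g h)
  then obtain n ys where xs: "xs = n # ys"
    by (auto split: list.splits)
  \<comment> \<open>The structural induction hypotheses cover \<open>g\<close> and \<open>h\<close>
    only, so the recursion argument needs an induction of its own.\<close>
  have "oeval (PrimRec g h) p (n # ys) = Some v \<Longrightarrow>
      \<forall>\<^sub>F p' in nhds p. oeval (PrimRec g h) p' (n # ys) = Some v"
  proof (induction n arbitrary: v)
    case 0
    then show ?case using PrimRec.IH(1) by simp
  next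
    case (Suc n)
    then obtain w where w: "oeval (PrimRec g h) p (n # ys) = Some w"
        and h: "oeval h p (n # w # ys) = Some v"
      by (auto simp: bind_eq_Some_conv)
    show ?case
      using Suc.IH[OF w] PrimRec.IH(2)[OF h] by eventually_elim simp
  qed
  then show ?case using PrimRec.prems xs by simp
next
  case (Minim g)
  from Minim.prems obtain n where n: "oeval g p (n # xs) = Some 0"
      "\<forall>i<n. oeval g p (i # xs) \<noteq> None"
      and v: "v = (LEAST n. oeval g p (n # xs) = Some 0)"
    by (auto split: if_splits)
  \<comment> \<open>The witness \<open>n\<close> need not be least, but \<open>v \<le> n\<close>, so
    below \<open>v\<close> all values exist and are nonzero. These values and the zero at
    \<open>v\<close> determine the search.\<close>
  have v0: "oeval g p (v # xs) = Some 0"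
    unfolding v using n(1) by (rule LeastI)
  have "v \<le> n"
    unfolding v using n(1) by (rule Least_le)
  then have below: "oeval g p (i # xs) \<noteq> None" "oeval g p (i # xs) \<noteq> Some 0" if "i < v" for i
    using n(2) that not_less_Least[of i "\<lambda>n. oeval g p (n # xs) = Some 0"] v by auto
  have "\<forall>\<^sub>F p' in nhds p. oeval g p' (i # xs) = oeval g p (i # xs)" if i: "i < v" for i
  proof -
    obtain w where "oeval g p (i # xs) = Some w"
      using below(1)[OF i] by auto
    then show ?thesis using Minim.IH by simp
  qed
  then have "\<forall>\<^sub>F p' in nhds p. \<forall>i\<in>{..<v}. oeval g p' (i # xs) = oeval g p (i # xs)"
    by (intro eventually_ball_finite) auto
  then show ?case
    using Minim.IH[OF v0]
  proof eventually_elim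
    case (elim p')
    have "(LEAST n. oeval g p' (n # xs) = Some 0) = v"
    proof (rule Least_equality)
      fix y assume y: "oeval g p' (y # xs) = Some 0"
      show "v \<le> y"
      proof (rule ccontr)
        assume "\<not> v \<le> y"
        then have "y < v" by simp
        with elim(1) y below(2) show False by auto
      qed
    qed (fact elim(2))
    moreover have "\<exists>n. oeval g p' (n # xs) = Some 0 \<and> (\<forall>i<n. oeval g p' (i # xs) \<noteq> None)"
      using elim below(1) by (intro exI[of _ v]) auto
    ultimately show ?case by simp
  qed
qed (auto split: list.splits)

lemma functional_of_SomeI:
  "(\<And>n. oeval e p [n] = Some (q n)) \<Longrightarrow> functional_of e p = Some q"
  by (simp add: functional_of_def)

lemma functional_of_SomeD:
  "functional_of e p = Some q \<Longrightarrow> oeval e p [n] = Some (q n)"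
  by (auto simp: functional_of_def split: if_splits)

lemma turing_functional_continuous:
  assumes "turing_functional \<Phi>"
  shows "continuous_functional \<Phi>"
proof -
  obtain e where \<Phi>: "\<Phi> = functional_of e"
    using assms by (auto simp: turing_functional_def)
  have "continuous_on (dom \<Phi>) (\<lambda>p. the (\<Phi> p) n)" for n
    unfolding continuous_on_def tendsto_discrete
  proof
    fix p assume "p \<in> dom \<Phi>"
    then obtain q where q: "functional_of e p = Some q"
      by (auto simp: \<Phi>)
    have "\<forall>\<^sub>F p' in at p within dom \<Phi>. oeval e p' [n] = Some (q n)"
      using oeval_eventually_nhds[OF functional_of_SomeD[OF q, of n]]
      unfolding eventually_at_filter by (rule eventually_mono) simp
    \<comment> \<open>Convergence at the single argument \<open>n\<close> does not make the sequence
      computed from \<open>p'\<close> total; membership in the domain has to be added.\<close>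
    moreover have "\<forall>\<^sub>F p' in at p within dom \<Phi>. p' \<in> dom \<Phi>"
      by (simp add: eventually_at_filter)
    ultimately show "\<forall>\<^sub>F p' in at p within dom \<Phi>. the (\<Phi> p') n = the (\<Phi> p) n"
    proof eventually_elim
      case (elim p')
      then obtain q' where "functional_of e p' = Some q'"
        by (auto simp: \<Phi>)
      with elim(1) q functional_of_SomeD[of e p' q' n] show ?case
        by (simp add: \<Phi>)
    qed
  qed
  then show ?thesis
    unfolding continuous_functional_def by (rule continuous_on_coordinatewise_then_product)
qed

lemma weihrauch_le_imp_cont_weihrauch_le: "P \<le>\<^sub>W Q \<Longrightarrow> P \<le>\<^sup>*\<^sub>W Q"
  unfolding weihrauch_le_def cont_weihrauch_le_def
  using turing_functional_continuous by blast

section \<open>Total computable functionals\<close>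

text \<open>Restricting to total functionals of fixed arity lets programs be assembled by closure
  lemmas. Partiality enters only in \<open>search_functional\<close>.\<close>

definition computable :: "nat \<Rightarrow> (baire \<Rightarrow> nat list \<Rightarrow> nat) \<Rightarrow> bool" where
  "computable a F \<longleftrightarrow> (\<exists>e. \<forall>p xs. length xs = a \<longrightarrow> oeval e p xs = Some (F p xs))"

definition decidable :: "nat \<Rightarrow> (baire \<Rightarrow> nat list \<Rightarrow> bool) \<Rightarrow> bool" where
  "decidable a P \<longleftrightarrow> computable a (\<lambda>p xs. of_bool (P p xs))"

lemma computableI:
  "(\<And>p xs. length xs = a \<Longrightarrow> oeval e p xs = Some (F p xs)) \<Longrightarrow> computable a F"
  by (auto simp: computable_def)

lemma computable_Proj: "i < a \<Longrightarrow> computable a (\<lambda>p xs. xs ! i)"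
  by (rule computableI[of _ "Proj i"]) simp

lemma computable_Suc:
  assumes "computable a F"
  shows "computable a (\<lambda>p xs. Suc (F p xs))"
proof -
  obtain e where "\<And>p xs. length xs = a \<Longrightarrow> oeval e p xs = Some (F p xs)"
    using assms by (auto simp: computable_def)
  then show ?thesis
    by (intro computableI[of _ "Comp Succ [e]"]) simp
qed

lemma computable_const: "computable a (\<lambda>p xs. c)"
proof (induction c)
  case 0
  show ?case by (rule computableI[of _ Zero]) simp
qed (rule computable_Suc)

lemma computable_query:
  assumes "computable a F"
  shows "computable a (\<lambda>p xs. p (F p xs))"
proof -
  obtain e where "\<And>p xs. length xs = a \<Longrightarrow> oeval e p xs = Some (F p xs)"
    using assms by (auto simp: computable_def)
  then show ?thesis
    by (intro computableI[of _ "Comp Query [e]"]) simp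
qed

lemma computable_comp1:
  assumes "computable 1 H" "computable a F"
  shows "computable a (\<lambda>p xs. H p [F p xs])"
proof -
  obtain e h where "\<And>p xs. length xs = a \<Longrightarrow> oeval e p xs = Some (F p xs)"
      "\<And>p xs. length xs = 1 \<Longrightarrow> oeval h p xs = Some (H p xs)"
    using assms by (auto simp: computable_def)
  then show ?thesis
    by (intro computableI[of _ "Comp h [e]"]) simp
qed

lemma computable_rec_nat:
  assumes "computable 2 H"
  shows "computable 1 (\<lambda>p xs. rec_nat c (\<lambda>i r. H p [i, r]) (xs ! 0))"
proof -
  obtain b h where b: "\<And>p. oeval b p [] = Some c"
      and h: "\<And>p xs. length xs = 2 \<Longrightarrow> oeval h p xs = Some (H p xs)"
    using assms computable_const[of 0 c] by (auto simp: computable_def)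
  have "oeval (PrimRec b h) p [n] = Some (rec_nat c (\<lambda>i r. H p [i, r]) n)" for p n
    by (induction n) (simp_all add: b h)
  then show ?thesis
    by (intro computableI[of _ "PrimRec b h"]) (auto simp: length_Suc_conv simp del: oeval.simps)
qed

lemma computable_if_zero:
  assumes "computable a F" "computable a G" "computable a H"
  shows "computable a (\<lambda>p xs. if F p xs = 0 then G p xs else H p xs)"
proof -
  obtain e g h where *: "\<And>p xs. length xs = a \<Longrightarrow> oeval e p xs = Some (F p xs)"
      "\<And>p xs. length xs = a \<Longrightarrow> oeval g p xs = Some (G p xs)"
      "\<And>p xs. length xs = a \<Longrightarrow> oeval h p xs = Some (H p xs)"
    using assms by (auto simp: computable_def)
  \<comment> \<open>The base program sees \<open>[y, z]\<close> and picks \<open>y\<close>; the step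
    program sees \<open>[i, v, y, z]\<close>, so index 3 is \<open>z\<close>. Strict composition
    evaluates both branches, which is harmless for total functionals.\<close>
  have ite: "oeval (PrimRec (Proj 0) (Proj 3)) p [x, y, z] = Some (if x = 0 then y else z)" for p x y z
    by (induction x) simp_all
  show ?thesis
    by (rule computableI[of _ "Comp (PrimRec (Proj 0) (Proj 3)) [e, g, h]"])
      (simp add: * ite del: oeval.simps(6))
qed

lemma computable_if:
  assumes "decidable a P" "computable a G" "computable a H"
  shows "computable a (\<lambda>p xs. if P p xs then G p xs else H p xs)"
proof -
  have "(\<lambda>p xs. if P p xs then G p xs else H p xs) =
      (\<lambda>p xs. if of_bool (P p xs) = (0::nat) then H p xs else G p xs)"
    by (intro ext) auto
  then show ?thesis
    using computable_if_zero[OF assms(1)[unfolded decidable_def] assms(3,2)] by simp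
qed

text \<open>Induction on the constant: equality with \<open>Suc c\<close> means being nonzero and
  having a predecessor equal to \<open>c\<close>. The predecessor comes from primitive
  recursion.\<close>

lemma decidable_eq_const:
  assumes "computable a F"
  shows "decidable a (\<lambda>p xs. F p xs = c)"
  using assms
proof (induction c arbitrary: F)
  case 0
  have "(\<lambda>p xs. of_bool (F p xs = 0)) = (\<lambda>p xs. if F p xs = 0 then 1 else 0 :: nat)"
    by (intro ext) auto
  then show ?case
    unfolding decidable_def
    using computable_if_zero[OF 0 computable_const[of a 1] computable_const[of a 0]] by simp
next
  case (Suc c)
  have "rec_nat 0 (\<lambda>i r. i) n = n - 1" for n
    by (cases n) simp_all
  then have "computable 1 (\<lambda>p xs. xs ! 0 - 1)"
    using computable_rec_nat[OF computable_Proj[of 0 2], of 0] by simp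
  from computable_comp1[OF this Suc.prems]
  have "decidable a (\<lambda>p xs. F p xs - 1 = c)"
    by (intro Suc.IH) simp
  from computable_if_zero[OF Suc.prems computable_const[of a 0] this[unfolded decidable_def]]
  have "computable a (\<lambda>p xs. if F p xs = 0 then 0 else of_bool (F p xs - 1 = c))" .
  moreover have "(\<lambda>p xs. of_bool (F p xs = Suc c)) =
      (\<lambda>p xs. if F p xs = 0 then 0 else of_bool (F p xs - 1 = c) :: nat)"
    by (intro ext) auto
  ultimately show ?case
    unfolding decidable_def by simp
qed

lemma decidable_const: "decidable a (\<lambda>p xs. b)"
  unfolding decidable_def by (rule computable_const)

lemma decidable_if:
  assumes "decidable a P" "decidable a Q" "decidable a R"
  shows "decidable a (\<lambda>p xs. if P p xs then Q p xs else R p xs)"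
  using computable_if[OF assms(1) assms(2,3)[unfolded decidable_def]]
  unfolding decidable_def by (simp add: if_distrib)

lemma decidable_conj:
  assumes "decidable a P" "decidable a Q"
  shows "decidable a (\<lambda>p xs. P p xs \<and> Q p xs)"
proof -
  have "(\<lambda>p xs. P p xs \<and> Q p xs) = (\<lambda>p xs. if P p xs then Q p xs else False)"
    by (intro ext) auto
  then show ?thesis
    using decidable_if[OF assms decidable_const] by (simp only:)
qed

lemma decidable_disj:
  assumes "decidable a P" "decidable a Q"
  shows "decidable a (\<lambda>p xs. P p xs \<or> Q p xs)"
proof -
  have "(\<lambda>p xs. P p xs \<or> Q p xs) = (\<lambda>p xs. if P p xs then True else Q p xs)"
    by (intro ext) auto
  then show ?thesis
    using decidable_if[OF assms(1) decidable_const assms(2)] by (simp only:)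
qed

text \<open>The bound is fixed, so the quantifier unfolds into a finite conjunction, and the
  programs for the \<open>P l\<close> may be unrelated to each other.\<close>

lemma decidable_all_less:
  "(\<And>l. decidable a (P l)) \<Longrightarrow> decidable a (\<lambda>p xs. \<forall>l<(k::nat). P l p xs)"
  by (induction k) (simp_all add: decidable_const decidable_conj All_less_Suc)

lemma decidable_ex_less:
  "(\<And>l. decidable a (P l)) \<Longrightarrow> decidable a (\<lambda>p xs. \<exists>l<(k::nat). P l p xs)"
  by (induction k) (simp_all add: decidable_const decidable_disj Ex_less_Suc)

lemma decidable_member_finite:
  assumes "finite C" "computable a F"
  shows "decidable a (\<lambda>p xs. F p xs \<in> C)"
  using assms
  by (induction C rule: finite_induct)
    (simp_all add: decidable_const decidable_disj decidable_eq_const)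

text \<open>The function \<open>t\<close> is arbitrary: its values on the finite set
  \<open>C\<close> are hard-wired as constants, one case distinction per element.\<close>

lemma computable_finite_table:
  assumes "finite C" "computable a F" "computable a H"
  shows "computable a (\<lambda>p xs. if F p xs \<in> C then t (F p xs) else H p xs)"
  using assms(1)
proof (induction C rule: finite_induct)
  case empty
  show ?case using assms(3) by simp
next
  case (insert c C)
  have "(\<lambda>p xs. if F p xs \<in> insert c C then t (F p xs) else H p xs) =
     (\<lambda>p xs. if F p xs = c then t c else (if F p xs \<in> C then t (F p xs) else H p xs))"
    by (intro ext) auto
  then show ?case
    using computable_if[OF decidable_eq_const[OF assms(2)] computable_const insert.IH] by simp
qed

text \<open>Here the bound is an argument, so a primitive recursion carries a flag that becomes 1 at
  the first occurrence. The arity \<open>a\<close> is left open because the test is used both in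
  outputs and in search conditions.\<close>

lemma decidable_bounded_occurrence:
  assumes "computable 1 R" "0 < a"
  shows "decidable a (\<lambda>p xs. \<exists>t<xs ! 0. R p [t] = v)"
proof -
  have "computable 2 (\<lambda>p xs. if R p [xs ! 0] = v then 1 else xs ! 1)"
    by (intro computable_if decidable_eq_const computable_comp1[OF assms(1)] computable_Proj
        computable_const) simp_all
  from computable_rec_nat[OF this, of 0]
  have "computable 1 (\<lambda>p xs. rec_nat 0 (\<lambda>i r. if R p [i] = v then 1 else r) (xs ! 0))"
    by (simp cong: if_cong)
  moreover have "rec_nat 0 (\<lambda>i r. if R p [i] = v then 1 else r) n =
      (of_bool (\<exists>t<n. R p [t] = v) :: nat)" for p n
    by (induction n) (auto simp: less_Suc_eq)
  ultimately have "computable 1 (\<lambda>p xs. of_bool (\<exists>t<xs ! 0. R p [t] = v))"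
    by simp
  from computable_comp1[OF this computable_Proj[of 0 a]] assms(2) show ?thesis
    by (simp add: decidable_def)
qed

section \<open>Case distinction over finitely many indices\<close>

primrec select :: "nat \<Rightarrow> (nat \<Rightarrow> bool) \<Rightarrow> (nat \<Rightarrow> 'a) \<Rightarrow> 'a \<Rightarrow> 'a" where
  "select 0 P v d = d"
| "select (Suc k) P v d = (if P k then v k else select k P v d)"

lemma select_default: "(\<And>l. l < k \<Longrightarrow> \<not> P l) \<Longrightarrow> select k P v d = d"
  by (induction k) simp_all

lemma select_unique:
  "l < k \<Longrightarrow> P l \<Longrightarrow> (\<And>l'. l' < k \<Longrightarrow> P l' \<Longrightarrow> l' = l) \<Longrightarrow> select k P v d = v l"
proof (induction k)
  case (Suc k)
  show ?case
  proof (cases "P k")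
    case True
    then show ?thesis using Suc.prems(3)[of k] by simp
  next
    case False
    then have "l < k" using Suc.prems(1,2) by (metis less_SucE)
    then have "select k P v d = v l"
      by (intro Suc.IH Suc.prems(2)) (auto intro: Suc.prems(3))
    with False show ?thesis by simp
  qed
qed simp

lemma select_in: "(\<And>l. l < k \<Longrightarrow> v l \<in> V) \<Longrightarrow> d \<in> V \<Longrightarrow> select k P v d \<in> V"
  by (induction k) (simp_all add: less_SucI)

lemma select_comp: "h (select k P v d) = select k P (\<lambda>l. h (v l)) (h d)"
  by (induction k) simp_all

text \<open>For fixed \<open>k\<close> the selection is a cascade of \<open>k\<close> tests with
  constant results.\<close>

lemma computable_select:
  assumes "\<And>l. decidable a (P l)"
  shows "computable a (\<lambda>p xs. select k (\<lambda>l. P l p xs) v d)"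
proof (induction k)
  case 0
  show ?case using computable_const by simp
next
  case (Suc k)
  from computable_if[OF assms computable_const this] show ?case by simp
qed


text \<open>\<open>Minim\<close> puts the candidate \<open>s\<close> in front of the output
  position, hence arity 2 for the condition. The output sequence is constant, which suffices because
  a number is coded by the first entry.\<close>

lemma search_functional:
  assumes "decidable 2 (\<lambda>p xs. P p (xs ! 0))" "computable 1 H"
  shows "\<exists>e. \<forall>p. (\<exists>s. P p s) \<longrightarrow> functional_of e p = Some (\<lambda>n. H p [LEAST s. P p s])"
proof -
  have "computable 2 (\<lambda>p xs. if P p (xs ! 0) then 0 else 1)"
    by (intro computable_if assms(1) computable_const)
  then obtain c where "\<And>p xs. length xs = 2 \<Longrightarrow>
      oeval c p xs = Some (if P p (xs ! 0) then 0 else 1)"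
    by (auto simp: computable_def)
  then have c: "oeval c p [s, n] = Some (if P p s then 0 else 1)" for p s n
    by simp
  obtain h where h: "\<And>p xs. length xs = 1 \<Longrightarrow> oeval h p xs = Some (H p xs)"
    using assms(2) by (auto simp: computable_def)
  have "functional_of (Comp h [Minim c]) p = Some (\<lambda>n. H p [LEAST s. P p s])"
    if "\<exists>s. P p s" for p
  proof (rule functional_of_SomeI)
    fix n
    have "oeval (Minim c) p [n] = Some (LEAST s. P p s)"
      using that by (simp add: c)
    then show "oeval (Comp h [Minim c]) p [n] = Some (H p [LEAST s. P p s])"
      by (simp add: h del: oeval.simps(7))
  qed
  then show ?thesis by blast
qed

section \<open>From separating functions to a reduction\<close>

text \<open>Evidence available at stage \<open>s\<close> that a number below \<open>k\<close>
  missing from \<open>r\<close> can only be \<open>l\<close>.\<close>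

definition all_seen_but :: "nat \<Rightarrow> baire \<Rightarrow> nat \<Rightarrow> nat \<Rightarrow> bool" where
  "all_seen_but k r s l \<longleftrightarrow> (\<forall>l'<k. l' = l \<or> (\<exists>t<s. r t = l'))"

lemma decidable_all_seen_but:
  assumes "computable 1 R" "0 < a"
  shows "decidable a (\<lambda>p xs. all_seen_but k (\<lambda>t. R p [t]) (xs ! 0) l)"
  unfolding all_seen_but_def
  by (intro decidable_all_less decidable_disj decidable_const
      decidable_bounded_occurrence assms)

text \<open>Each of the finitely many numbers other than \<open>l\<close> occurs at some position,
  and any stage beyond all these positions works.\<close>

lemma all_seen_but_eventually:
  assumes "\<And>l'. l' < k \<Longrightarrow> l' \<notin> range r \<Longrightarrow> l' = l"
  shows "\<forall>\<^sub>F s in sequentially. all_seen_but k r s l"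
proof -
  have "\<forall>\<^sub>F s in sequentially. l' = l \<or> (\<exists>t<s. r t = l')" if "l' \<in> {..<k}" for l'
  proof (cases "l' = l")
    case False
    with assms that obtain t where "r t = l'" by blast
    then show ?thesis
      by (intro eventually_mono[OF eventually_gt_at_top[of t]]) blast
  qed simp
  then have "\<forall>\<^sub>F s in sequentially. \<forall>l'\<in>{..<k}. l' = l \<or> (\<exists>t<s. r t = l')"
    by (intro eventually_ball_finite) auto
  then show ?thesis
    by (rule eventually_mono) (simp add: all_seen_but_def)
qed

lemma all_seen_but_missing:
  "all_seen_but k r s l' \<Longrightarrow> l < k \<Longrightarrow> l \<notin> range r \<Longrightarrow> l' = l"
  by (auto simp: all_seen_but_def)

lemma select_all_seen_but:
  assumes "l < k" "l \<notin> range r" "all_seen_but k r s l"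
  shows "select k (all_seen_but k r s) v d = v l"
  by (rule select_unique[where P = "all_seen_but k r s", OF assms(1,3)]) (rule all_seen_but_missing[OF _ assms(1,2)])

text \<open>Neither 0 nor 1 occurs in the constant sequence, and \<open>l\<close> cannot be
  both.\<close>

lemma not_all_seen_but_const:
  assumes "k \<ge> 2"
  shows "\<not> all_seen_but k (\<lambda>_. k) s l"
proof
  assume *: "all_seen_but k (\<lambda>_. k) s l"
  have "l = 0" "l = 1"
    using all_seen_but_missing[OF *, of 0] all_seen_but_missing[OF *, of 1] assms by auto
  then show False by simp
qed

text \<open>The sequences produced by the forward functional become constant, so their solutions can
  be computed from the final function alone.\<close>

lemma PHP_jump_eventually_const:
  assumes "\<And>s. F s \<in> instances (PHP m n)" and "\<forall>\<^sub>F s in sequentially. F s = h"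
  shows "F \<in> instances (PHP_jump m n)"
    and "solutions (PHP_jump m n) F = solutions (PHP m n) h"
proof -
  have lim: "(\<lambda>s. F s i) \<longlonglongrightarrow> h i" for i
    using assms(2) by (intro tendsto_eventually) (auto elim: eventually_mono)
  then show "F \<in> instances (PHP_jump m n)"
    using assms(1) by (auto simp: PHP_def PHP_jump_def convergent_def)
  show "solutions (PHP_jump m n) F = solutions (PHP m n) h"
    using limI[OF lim] by (simp add: PHP_def PHP_jump_def)
qed

lemma finite_PHP_solution: "A \<in> solutions (PHP m n) h \<Longrightarrow> finite A"
  by (auto simp: PHP_def)

lemma finite_PHP_solutions: "finite (solutions (PHP m n) h)"
proof (rule finite_subset)
  show "solutions (PHP m n) h \<subseteq> Pow {..<m}"
    by (auto simp: PHP_def)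
qed simp

lemma AUC_le_PHP_jump:
  assumes k: "k \<ge> 2"
    and g: "g \<in> instances (PHP m n)" and f: "\<And>l. l < k \<Longrightarrow> f l \<in> instances (PHP m n)"
    and sep: "\<And>l l' A. l < k \<Longrightarrow> l' < k \<Longrightarrow> A \<in> solutions (PHP m n) (f l) \<Longrightarrow>
      A \<in> solutions (PHP m n) (f l') \<Longrightarrow> A \<in> solutions (PHP m n) g \<Longrightarrow> l = l'"
  shows "AUC k \<le>\<^sub>W PHP_jump m n"
proof -
  have "computable 1 (\<lambda>p xs. select k (all_seen_but k p (xs ! 0))
      (\<lambda>l. fun_code m (f l)) (fun_code m g))"
    using computable_select[OF decidable_all_seen_but[OF computable_query[OF computable_Proj[of 0 1]]]]
    by simp
  then obtain e1 where "\<And>p s. oeval e1 p [s] = Some (select k (all_seen_but k p s)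
      (\<lambda>l. fun_code m (f l)) (fun_code m g))"
    unfolding computable_def by (metis (no_types, lifting) length_Cons list.size(3) nth_Cons_0 One_nat_def)
  then have e1: "functional_of e1 p = Some (\<lambda>s. fun_code m (select k (all_seen_but k p s) f g))" for p
    by (intro functional_of_SomeI) (simp add: select_comp[of "fun_code m"])

  \<comment> \<open>Below, \<open>r\<close> stands for \<open>join x q\<close>: the instance
    occupies the even positions and the code of the solution is \<open>r 1\<close>. Codes of
    solutions of \<open>g\<close> are answered by the table \<open>T\<close>, all others by the
    evidence \<open>D\<close>.\<close>
  define C where "C = set_encode ` solutions (PHP m n) g"
  define T where "T = (\<lambda>c. select k (\<lambda>l. set_decode c \<in> solutions (PHP m n) (f l)) (\<lambda>l. l) 0)"
  define D where "D = (\<lambda>r s l. all_seen_but k (\<lambda>t. r (2 * t)) s l)"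
  define H where "H = (\<lambda>r s. if r 1 \<in> C then T (r 1) else select k (D r s) (\<lambda>l. l) 0)"
  have C: "finite C"
    by (simp add: C_def finite_PHP_solutions)
  \<comment> \<open>Doubling is needed to read the instance off the even positions.\<close>
  have "rec_nat 0 (\<lambda>i r. Suc (Suc r)) x = 2 * x" for x :: nat
    by (induction x) simp_all
  with computable_rec_nat[OF computable_Suc[OF computable_Suc[OF computable_Proj[of 1 2]]], of 0]
  have "computable 1 (\<lambda>r xs. 2 * xs ! 0)"
    by simp
  from decidable_all_seen_but[OF computable_query[OF this]]
  have D: "decidable a (\<lambda>r xs. D r (xs ! 0) l)" if "0 < a" for a l
    using that by (simp add: D_def)
  \<comment> \<open>The search stops at once if the table applies and otherwise waits for
    evidence.\<close>
  have "decidable 2 (\<lambda>r xs. r 1 \<in> C \<or> (\<exists>l<k. D r (xs ! 0) l))"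
    by (intro decidable_disj decidable_member_finite C computable_query computable_const
        decidable_ex_less D) simp
  moreover have "computable 1 (\<lambda>r xs. H r (xs ! 0))"
    unfolding H_def
    by (intro computable_finite_table C computable_query computable_const computable_select D) simp
  ultimately obtain e2 where e2: "\<And>r. (\<exists>s. r 1 \<in> C \<or> (\<exists>l<k. D r s l)) \<Longrightarrow>
      functional_of e2 r = Some (\<lambda>_. H r (LEAST s. r 1 \<in> C \<or> (\<exists>l<k. D r s l)))"
    using search_functional[of "\<lambda>r s. r 1 \<in> C \<or> (\<exists>l<k. D r s l)" "\<lambda>r xs. H r (xs ! 0)"]
    unfolding nth_Cons_0 by blast

  have D_join: "D (join p q) s l = all_seen_but k p s l" for p q s l
    by (simp add: D_def join_def)
  have code_C: "set_encode A \<in> C \<longleftrightarrow> A \<in> solutions (PHP m n) g" if "finite A" for A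
    unfolding C_def using that finite_PHP_solution by (metis (no_types, lifting) image_iff set_encode_inverse)
  \<comment> \<open>For the constant instance every number below \<open>k\<close> is correct, so
    this bound is all that is asked of \<open>T\<close> there; the default 0 respects it.\<close>
  have T_less: "T c < k" for c
    using select_in[of k "\<lambda>l. l" "{..<k}" 0] k by (auto simp: T_def)

  have "reduces_via (functional_of e1) (functional_of e2) (AUC k) (PHP_jump m n)"
    unfolding reduces_via_def
  proof (intro ballI allI impI)
    fix x p assume x: "x \<in> instances (AUC k)" and "inst_name (AUC k) p x"
    then have p: "p = x" by (simp add: AUC_def)
    define F where "F = (\<lambda>s. select k (all_seen_but k x s) f g)"
    have F_inst: "F s \<in> instances (PHP m n)" for s
      unfolding F_def using f g by (intro select_in) auto
    \<comment> \<open>The eventual value \<open>h\<close> is \<open>g\<close> for the constant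
      instance and \<open>f l\<close> for an instance missing exactly \<open>l\<close>.\<close>
    obtain h where h: "\<forall>\<^sub>F s in sequentially. F s = h"
        and answer: "\<And>A q. A \<in> solutions (PHP m n) h \<Longrightarrow> q 0 = set_encode A \<Longrightarrow>
          \<exists>r. functional_of e2 (join x q) = Some r \<and> r 0 \<in> solutions (AUC k) x"
    proof (cases "x = (\<lambda>_. k)")
      case True
      have "F s = g" for s
        unfolding F_def True using not_all_seen_but_const[OF k] by (intro select_default) blast
      then have "\<forall>\<^sub>F s in sequentially. F s = g" by simp
      moreover have "\<exists>r. functional_of e2 (join x q) = Some r \<and> r 0 \<in> solutions (AUC k) x"
        if A: "A \<in> solutions (PHP m n) g" and q: "q 0 = set_encode A" for A q
      proof -
        have "join x q 1 \<in> C"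
          using q A by (simp add: join_def C_def)
        then show ?thesis
          using e2[of "join x q"] True T_less by (simp add: H_def AUC_def)
      qed
      ultimately show thesis by (rule that)
    next
      case False
      then have "\<exists>!l. l < k \<and> l \<notin> range x"
        using x unfolding AUC_def problem.simps by blast
      then obtain l where l: "l < k" "l \<notin> range x"
          and uniq: "\<And>l'. l' < k \<Longrightarrow> l' \<notin> range x \<Longrightarrow> l' = l"
        by blast
      have l_sol: "l \<in> solutions (AUC k) x"
        using False l by (simp add: AUC_def)
      have ev: "\<forall>\<^sub>F s in sequentially. all_seen_but k x s l"
        using all_seen_but_eventually uniq by blast
      have "\<forall>\<^sub>F s in sequentially. F s = f l"
        using ev
      proof eventually_elim
        case (elim s)
        show ?case
          unfolding F_def by (rule select_all_seen_but[OF l elim])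
      qed
      moreover have "\<exists>r. functional_of e2 (join x q) = Some r \<and> r 0 \<in> solutions (AUC k) x"
        if A: "A \<in> solutions (PHP m n) (f l)" and q: "q 0 = set_encode A" for A q
      proof -
        let ?P = "\<lambda>s. join x q 1 \<in> C \<or> (\<exists>l<k. D (join x q) s l)"
        have q1: "join x q 1 = set_encode A"
          using q by (simp add: join_def)
        have A_fin: "finite A"
          using A by (rule finite_PHP_solution)
        obtain s0 where "all_seen_but k x s0 l"
          using ev by (auto simp: eventually_sequentially)
        \<comment> \<open>Evidence for \<open>l\<close> appears at \<open>s0\<close>, so the search
          ends whether or not the table applies.\<close>
        then have ex: "\<exists>s. ?P s"
          using l(1) D_join by blast
        have "H (join x q) (LEAST s. ?P s) = l"
        proof (cases "join x q 1 \<in> C")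
          case True
          then have Ag: "A \<in> solutions (PHP m n) g"
            using q1 code_C A_fin by simp
          \<comment> \<open>Since \<open>A\<close> also solves \<open>g\<close>, \<open>sep\<close>
            leaves \<open>l\<close> as the only index whose function has the solution
            \<open>A\<close>.\<close>
          have "T (set_encode A) = l"
            unfolding T_def set_encode_inverse[OF A_fin]
            by (rule select_unique[where P = "\<lambda>l. A \<in> solutions (PHP m n) (f l)", OF l(1) A])
              (rule sep[OF _ l(1) _ A Ag])
          with True q1 show ?thesis by (simp add: H_def)
        next
          case False
          \<comment> \<open>The search ended without the table, hence with evidence for some
            \<open>l'\<close>; as \<open>l\<close> is missing, this must be
            \<open>l\<close>.\<close>
          with LeastI_ex[OF ex] obtain l' where "l' < k" "all_seen_but k x (LEAST s. ?P s) l'"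
            unfolding D_join by blast
          moreover from this(2) have "l' = l"
            by (rule all_seen_but_missing[OF _ l])
          ultimately have "select k (D (join x q) (LEAST s. ?P s)) (\<lambda>l. l) 0 = l"
            unfolding D_join by (intro select_all_seen_but[OF l]) simp
          with False show ?thesis by (simp add: H_def)
        qed
        with e2[OF ex] l_sol show ?thesis by simp
      qed
      ultimately show thesis by (rule that)
    qed
    note F = PHP_jump_eventually_const[OF F_inst h]
    have "\<exists>r. functional_of e2 (join p q) = Some r \<and>
          (\<exists>y\<in>solutions (AUC k) x. sol_name (AUC k) r y)"
      if "A \<in> solutions (PHP_jump m n) F" and q: "sol_name (PHP_jump m n) q A" for A q
    proof -
      have "A \<in> solutions (PHP m n) h"
        using that(1) F(2) by simp
      moreover from q have "q 0 = set_encode A"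
        by (simp add: PHP_jump_def)
      ultimately obtain r where "functional_of e2 (join x q) = Some r"
          "r 0 \<in> solutions (AUC k) x"
        using answer by blast
      moreover have "sol_name (AUC k) r (r 0)"
        by (simp add: AUC_def)
      ultimately show ?thesis
        using p by blast
    qed
    moreover have "functional_of e1 p = Some (\<lambda>s. fun_code m (F s))"
      by (simp add: e1 F_def p)
    moreover have "inst_name (PHP_jump m n) (\<lambda>s. fun_code m (F s)) F"
      by (simp add: PHP_jump_def)
    ultimately show "\<exists>p'. functional_of e1 p = Some p' \<and>
        (\<exists>u\<in>instances (PHP_jump m n). inst_name (PHP_jump m n) p' u \<and>
          (\<forall>v\<in>solutions (PHP_jump m n) u. \<forall>q. sol_name (PHP_jump m n) q v \<longrightarrow>
            (\<exists>r. functional_of e2 (join p q) = Some r \<and>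
              (\<exists>y\<in>solutions (AUC k) x. sol_name (AUC k) r y))))"
      using F(1) by blast
  qed
  then show ?thesis
    unfolding weihrauch_le_def turing_functional_def by blast
qed

section \<open>From a continuous reduction to separating functions\<close>

text \<open>The limit function is restricted to \<open>{..<m}\<close> because instances are
  extensional. Its values stay below \<open>n\<close> since a limit in a discrete space is
  attained.\<close>

lemma PHP_jump_limit:
  assumes "F \<in> instances (PHP_jump m n)"
  obtains h where "h \<in> instances (PHP m n)" "solutions (PHP m n) h = solutions (PHP_jump m n) F"
proof
  let ?h = "\<lambda>i\<in>{..<m}. lim (\<lambda>s. F s i)"
  have "lim (\<lambda>s. F s i) < n" if i: "i < m" for i
  proof -
    have "(\<lambda>s. F s i) \<longlonglongrightarrow> lim (\<lambda>s. F s i)"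
      using assms i by (simp add: PHP_jump_def convergent_LIMSEQ_iff)
    then obtain s where "F s i = lim (\<lambda>s. F s i)"
      unfolding tendsto_discrete eventually_sequentially by blast
    moreover have "F s i < n"
      using assms i by (auto simp: PHP_jump_def PiE_iff)
    ultimately show ?thesis by simp
  qed
  then show "?h \<in> instances (PHP m n)"
    by (simp add: PHP_def)
  show "solutions (PHP m n) ?h = solutions (PHP_jump m n) F"
    by (auto simp: PHP_def PHP_jump_def)
qed

section \<open>Pointwise convergence and local constancy in Baire space\<close>

lemma LIMSEQ_baire:
  fixes P :: "nat \<Rightarrow> baire"
  assumes "\<And>i. \<forall>\<^sub>F N in sequentially. P N i = p i"
  shows "P \<longlonglongrightarrow> p"
proof -
  have "limitin (product_topology (\<lambda>i. euclidean) UNIV) P p sequentially"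
    unfolding limitin_componentwise using assms by (auto intro: tendsto_eventually)
  then show ?thesis
    by (simp add: euclidean_product_topology)
qed

text \<open>Coordinates take values in a discrete space, so continuity at \<open>p\<close> makes
  coordinate \<open>i\<close> constant on a neighbourhood of \<open>p\<close> within the domain, and
  \<open>P\<close> eventually enters it.\<close>

lemma continuous_functional_eventually:
  assumes \<Psi>: "continuous_functional \<Psi>" and lim: "P \<longlonglongrightarrow> p" and p: "p \<in> dom \<Psi>"
  shows "\<forall>\<^sub>F N in sequentially. P N \<in> dom \<Psi> \<longrightarrow> the (\<Psi> (P N)) i = the (\<Psi> p) i"
proof -
  have "continuous_on (dom \<Psi>) (\<lambda>p. the (\<Psi> p) i)"
    using \<Psi> unfolding continuous_functional_def by (rule continuous_on_product_then_coordinatewise)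
  with p have "\<forall>\<^sub>F p' in at p within dom \<Psi>. the (\<Psi> p') i = the (\<Psi> p) i"
    by (simp add: continuous_on_def tendsto_discrete)
  then obtain U where U: "open U" "p \<in> U"
      "\<And>p'. p' \<in> U \<Longrightarrow> p' \<noteq> p \<Longrightarrow> p' \<in> dom \<Psi> \<Longrightarrow> the (\<Psi> p') i = the (\<Psi> p) i"
    unfolding eventually_at_topological by blast
  from topological_tendstoD[OF lim U(1,2)] show ?thesis
    by (rule eventually_mono) (use U(3) in blast)
qed

text \<open>The value \<open>k\<close> does not count as an appearance of any \<open>l < k\<close>, so it serves as filler.\<close>

definition delayed_instance :: "nat \<Rightarrow> nat \<Rightarrow> nat \<Rightarrow> baire" where
  "delayed_instance k l N = (\<lambda>t. if t < N \<or> t mod k = l then k else t mod k)"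

lemma delayed_instance_missing:
  assumes "l < k"
  shows "l' < k \<and> l' \<notin> range (delayed_instance k l N) \<longleftrightarrow> l' = l"
proof
  assume l': "l' < k \<and> l' \<notin> range (delayed_instance k l N)"
  show "l' = l"
  proof (rule ccontr)
    assume "l' \<noteq> l"
    \<comment> \<open>The position \<open>l' + N * k\<close> has remainder \<open>l'\<close> modulo
      \<open>k\<close> and lies beyond the filler, because \<open>k\<close> is positive.\<close>
    moreover have "N \<le> l' + N * k"
      using assms by (cases k) auto
    ultimately have "delayed_instance k l N (l' + N * k) = l'"
      using l' by (simp add: delayed_instance_def)
    with l' show False by (metis rangeI)
  qed
next
  assume "l' = l"
  with assms show "l' < k \<and> l' \<notin> range (delayed_instance k l N)"
    by (auto simp: delayed_instance_def)
qed

lemma delayed_instance_AUC: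
  assumes "k \<ge> 2" "l < k"
  shows "delayed_instance k l N \<in> instances (AUC k)"
    and "solutions (AUC k) (delayed_instance k l N) = {l}"
proof -
  note missing = delayed_instance_missing[OF assms(2), of _ N]
  show "delayed_instance k l N \<in> instances (AUC k)"
    by (simp add: AUC_def missing)
  \<comment> \<open>A second number below \<open>k\<close> must appear, which distinguishes the
    sequence from the constant one and rules out the other clause for solutions.\<close>
  obtain l' where "l' < k" "l' \<noteq> l"
    using assms that[of 0] that[of 1] by fastforce
  then have "l' \<in> range (delayed_instance k l N)"
    using missing by blast
  with \<open>l' < k\<close> have "delayed_instance k l N \<noteq> (\<lambda>_. k)"
    by auto
  then show "solutions (AUC k) (delayed_instance k l N) = {l}"
    by (simp add: AUC_def missing)
qed

lemma cont_reduction_imp_separating: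
  assumes k: "k \<ge> 2" and le: "AUC k \<le>\<^sup>*\<^sub>W PHP_jump m n"
  shows "\<exists>g f. g \<in> instances (PHP m n) \<and> (\<forall>l<k. f l \<in> instances (PHP m n)) \<and>
    (\<forall>l<k. \<forall>l'<k. l \<noteq> l' \<longrightarrow>
      \<not> (\<exists>A. A \<in> solutions (PHP m n) (f l) \<and> A \<in> solutions (PHP m n) (f l') \<and>
              A \<in> solutions (PHP m n) g))"
proof -
  obtain \<Phi> \<Psi> where \<Psi>: "continuous_functional \<Psi>" and red: "reduces_via \<Phi> \<Psi> (AUC k) (PHP_jump m n)"
    using le by (auto simp: cont_weihrauch_le_def)
  \<comment> \<open>One fixed name per solution is chosen, so that the backward answer depends on
    \<open>x\<close> and \<open>A\<close> alone.\<close>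
  define Q where "Q = (\<lambda>x A. join x (\<lambda>_. set_encode A))"
  have "\<exists>h. h \<in> instances (PHP m n) \<and> (\<forall>A\<in>solutions (PHP m n) h.
      Q x A \<in> dom \<Psi> \<and> the (\<Psi> (Q x A)) 0 \<in> solutions (AUC k) x)"
    if x: "x \<in> instances (AUC k)" for x
  proof -
    have "inst_name (AUC k) x x"
      by (simp add: AUC_def)
    with red x obtain F where F: "F \<in> instances (PHP_jump m n)"
        and sol: "\<And>A q. A \<in> solutions (PHP_jump m n) F \<Longrightarrow> sol_name (PHP_jump m n) q A \<Longrightarrow>
          \<exists>r. \<Psi> (join x q) = Some r \<and> (\<exists>y\<in>solutions (AUC k) x. sol_name (AUC k) r y)"
      unfolding reduces_via_def by blast
    obtain h where h: "h \<in> instances (PHP m n)"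
        "solutions (PHP m n) h = solutions (PHP_jump m n) F"
      using PHP_jump_limit[OF F] by blast
    have "Q x A \<in> dom \<Psi> \<and> the (\<Psi> (Q x A)) 0 \<in> solutions (AUC k) x"
      if A: "A \<in> solutions (PHP m n) h" for A
    proof -
      have "sol_name (PHP_jump m n) (\<lambda>_. set_encode A) A"
        by (simp add: PHP_jump_def)
      with sol A h(2) obtain r y where "\<Psi> (Q x A) = Some r"
          "y \<in> solutions (AUC k) x" "sol_name (AUC k) r y"
        unfolding Q_def by blast
      moreover from this(3) have "r 0 = y"
        by (simp add: AUC_def)
      ultimately show ?thesis by auto
    qed
    with h(1) show ?thesis by blast
  qed
  \<comment> \<open>\<open>h x\<close> is a choice of the limit that the reduction produces for
    \<open>x\<close>.\<close>
  then obtain h where h: "\<And>x. x \<in> instances (AUC k) \<Longrightarrow> h x \<in> instances (PHP m n)"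
    and h_sol: "\<And>x A. x \<in> instances (AUC k) \<Longrightarrow> A \<in> solutions (PHP m n) (h x) \<Longrightarrow>
      Q x A \<in> dom \<Psi> \<and> the (\<Psi> (Q x A)) 0 \<in> solutions (AUC k) x"
    by metis
  define c :: baire where "c = (\<lambda>_. k)"
  have c: "c \<in> instances (AUC k)"
    by (simp add: AUC_def c_def)
  let ?d = "delayed_instance k"
  have "\<forall>\<^sub>F N in sequentially. Q (?d l N) A \<in> dom \<Psi> \<longrightarrow>
      the (\<Psi> (Q (?d l N) A)) 0 = the (\<Psi> (Q c A)) 0"
    if "A \<in> solutions (PHP m n) (h c)" for A l
  proof (rule continuous_functional_eventually[OF \<Psi>])
    show "Q c A \<in> dom \<Psi>"
      using h_sol[OF c that] by simp
    show "(\<lambda>N. Q (?d l N) A) \<longlonglongrightarrow> Q c A"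
    proof (rule LIMSEQ_baire)
      fix i
      show "\<forall>\<^sub>F N in sequentially. Q (?d l N) A i = Q c A i"
        using eventually_gt_at_top[of i]
        by (rule eventually_mono) (auto simp: Q_def join_def delayed_instance_def c_def)
    qed
  qed
  \<comment> \<open>There are finitely many \<open>l\<close> and finitely many solutions of
    \<open>h c\<close>, so a single \<open>N\<close> serves them all.\<close>
  then have "\<forall>\<^sub>F N in sequentially. \<forall>l\<in>{..<k}. \<forall>A\<in>solutions (PHP m n) (h c).
      Q (?d l N) A \<in> dom \<Psi> \<longrightarrow> the (\<Psi> (Q (?d l N) A)) 0 = the (\<Psi> (Q c A)) 0"
    by (intro eventually_ball_finite finite_PHP_solutions ballI) auto
  then obtain N where N: "\<And>l A. l < k \<Longrightarrow> A \<in> solutions (PHP m n) (h c) \<Longrightarrow>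
      Q (?d l N) A \<in> dom \<Psi> \<Longrightarrow> the (\<Psi> (Q (?d l N) A)) 0 = the (\<Psi> (Q c A)) 0"
    unfolding eventually_sequentially by (meson lessThan_iff order_refl)
  \<comment> \<open>The delayed instance forces the answer \<open>l\<close>, and by the choice of
    \<open>N\<close> the answer at \<open>c\<close> is the same. That answer involves only
    \<open>A\<close>, so \<open>A\<close> determines \<open>l\<close>.\<close>
  have "the (\<Psi> (Q c A)) 0 = l" if "l < k" "A \<in> solutions (PHP m n) (h (?d l N))"
      "A \<in> solutions (PHP m n) (h c)" for l A
    using h_sol[OF delayed_instance_AUC(1)[OF k that(1)] that(2)] N[OF that(1,3)]
      delayed_instance_AUC(2)[OF k that(1)] by simp
  then show ?thesis
    using h[OF c] h[OF delayed_instance_AUC(1)[OF k]]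
    by (intro exI[of _ "h c"] exI[of _ "\<lambda>l. h (?d l N)"]) blast
qed

theorem theorem3p6:
  fixes k m n :: nat
  assumes "k \<ge> 2" and "m > n" and "n \<ge> 2"
  shows "((\<exists>g f. g \<in> instances (PHP m n) \<and> (\<forall>l<k. f l \<in> instances (PHP m n)) \<and>
             (\<forall>l<k. \<forall>l'<k. l \<noteq> l' \<longrightarrow>
                \<not> (\<exists>A. A \<in> solutions (PHP m n) (f l) \<and>
                        A \<in> solutions (PHP m n) (f l') \<and>
                        A \<in> solutions (PHP m n) g)))
           \<longleftrightarrow> AUC k \<le>\<^sub>W PHP_jump m n) \<and>
         (AUC k \<le>\<^sub>W PHP_jump m n \<longleftrightarrow> AUC k \<le>\<^sup>*\<^sub>W PHP_jump m n)"
    (is "(?sep \<longleftrightarrow> _) \<and> _")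
proof -
  have "?sep \<Longrightarrow> AUC k \<le>\<^sub>W PHP_jump m n"
    using AUC_le_PHP_jump[OF assms(1)] by metis
  then show ?thesis
    using cont_reduction_imp_separating[OF assms(1)] weihrauch_le_imp_cont_weihrauch_le by blast
qed

end
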